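(* In the setting described in the context, for every $n\in2\mathbb{N}$, for a.e. $t\in\mathbb{R}_+$, $\mu$-a.e. $x\in X$ and all $\ell\in\{1,\dots,d\}$, the component $(\boldsymbol{\omega}^n_{t,x})_\ell$ of the discrete momentum is absolutely continuous with respect to $\boldsymbol{\pi}^n_{t,x}$ and $$\left|\frac{d(\boldsymbol{\omega}^n_{t,x})_\ell}{d\boldsymbol{\pi}^n_{t,x}}\right|\le1 .$$ Likewise, for the limit trajectory $\boldsymbol{\pi}$ and limit momentum $\boldsymbol{\omega}$ (as defined in the context), for a.e. $t\in\mathbb{R}_+$, $\mu$-a.e. $x\in X$ and all $\ell\in\{1,\dots,d\}$, $(\boldsymbol{\omega}_{t,x})_\ell\ll\boldsymbol{\pi}_{t,x}$ and $$\left|\frac{d(\boldsymbol{\omega}_{t,x})_\ell}{d\boldsymbol{\pi}_{t,x}}\right|\le1 .$$ In particular $\boldsymbol{\omega}^n\ll\boldsymbol{\pi}^n$ and $\boldsymbol{\omega}\ll\boldsymbol{\pi}$.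
   Context: Notation. $\mathbb{R}_+=[0,\infty)$, $\mathbb{N}=\{0,1,2,\dots\}$, $2\mathbb{N}$ denotes the positive even integers, $\mathcal{L}$ is Lebesgue measure; $\mathcal{M}(S)$, $\mathcal{M}_+(S)$, $\mathcal{P}(S)$ are the signed (Radon), non-negative (Radon) and probability measures on $S$; $\rho|_A$ is the restriction of a measure $\rho$ to $A$; $P_Y$ denotes the marginal on $Y$ (similarly for other factors); $\Pi(\alpha,\beta)$ is the set of non-negative measures on the product space with first marginal $\alpha$ and second marginal $\beta$. $\mathrm{KL}(\alpha|\beta)=\int\varphi(\frac{d\alpha}{d\beta})\,d\beta$ if $0\le\alpha\ll\beta$ and $+\infty$ otherwise, with $\varphi(s)=s\log s-s+1$ for $s>0$, $\varphi(0)=1$; the convention $0\cdot\infty=0$ is used. $W_Y$ is the Wasserstein-1 metric on $\mathcal{P}(Y)$. Subscripts $t$ or $t,x$ on a measure denote its disintegration with respect to $\mathcal{L}$ (in time) or $\mathcal{L}\otimes\mu$ (in time and $X$); $\mathcal{L}\otimes\mu\otimes\lambda_{t,x}$ denotes the measure with disintegration $\lambda_{t,x}$. Problem data. $d\ge1$, $X=[0,1]^d$, $Y\subset\mathbb{R}^d$ compact, $\mu\in\mathcal{P}(X)$ with $\mu\ll\mathcal{L}$, $\nu\in\mathcal{P}(Y)$, $c\in C^1(X\times Y)$, $\pi_{\mathrm{init}}\in\Pi(\mu,\nu)$. For $n\in2\mathbb{N}$: the basic cells are $X^n_i=i/n+[0,1/n]^d$, $i\in I^n=\{0,\dots,n-1\}^d$,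 and it is assumed that $m^n_i:=\mu(X^n_i)>0$. $\mu^n\in\mathcal{P}(X)$ satisfies $\mu^n(X^n_i)=m^n_i$ for all $i$ and gives no mass to boundaries of basic cells (hence overlaps of closed cells are irrelevant). $\nu^n\in\mathcal{P}(Y)$, $\nu^n\to\nu$ weak*; $\pi^n_{\mathrm{init}}\in\Pi(\mu^n,\nu^n)$, $\pi^n_{\mathrm{init}}\to\pi_{\mathrm{init}}$ weak*. $c^n=c+f^n/n$ is continuous, where $f^n:X\times Y\to\mathbb{R}$ converge uniformly to $0$. $\varepsilon^n\in[0,\infty)$ and $\eta:=\lim_{n\to\infty}n\varepsilon^n$ exists in $[0,\infty]$. Composite cells. $\mathcal{J}^n_A$ is the partition of $I^n$ into the groups of $2^d$ adjacent indices on which $(\lfloor i_\ell/2\rfloor)_{\ell=1}^d$ is constant; $\mathcal{J}^n_B$ is the partition into groups on which $(\lfloor (i_\ell+1)/2\rfloor)_{\ell=1}^d$ is constant (the same grouping shifted by one cell in each direction; boundary groups are smaller). For $J$ in either: $X^n_J=\bigcup_{i\in J}X^n_i$, $\mu^n_J=\mu^n|_{X^n_J}$, $m^n_J=\sum_{i\in J}m^n_i$, and the center $x^n_J$ is the unique point of $\{1/n,3/n,\dots,(n-1)/n\}^d$ (if $J\in\mathcal{J}^n_A$), resp. of $\{0,2/n,\dots,1\}^d$ (if $J\in\mathcal{J}^n_B$), contained in $X^n_J$. Set $\mathcal{J}^{n,k}=\mathcal{J}^n_A$ for $k$ odd and $\mathcal{J}^{n,k}=\mathcal{J}^n_B$ for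 $k$ even. Domain decomposition iterates. $\pi^{n,0}=\pi^n_{\mathrm{init}}$; for $k\ge1$, $\pi^{n,k}=\sum_{J\in\mathcal{J}^{n,k}}\pi^{n,k}_J$, where $\pi^{n,k}_J$ is a (selected) minimizer of $\int_{X^n_J\times Y}c^n\,d\pi+\varepsilon^n\,\mathrm{KL}(\pi|\mu^n_J\otimes\nu^n)$ over $\pi\in\Pi(\mu^n_J,P_Y(\pi^{n,k-1}|_{X^n_J\times Y}))$. Set $\nu^{n,k}_i=P_Y(\pi^{n,k}|_{X^n_i\times Y})$, $\nu^{n,k}_J=\sum_{i\in J}\nu^{n,k}_i$. Discrete trajectories and momenta. For $t\ge0$, $x\in X$, with $k=\lfloor nt\rfloor$ and $J=J^n_{t,x}$ the ($\mu$-a.e. unique) cell in $\mathcal{J}^{n,k}$ with $x\in X^n_J$, $$\boldsymbol{\pi}^n_{t,x}=\frac{1}{m^n_J}\nu^{n,k}_J,\qquad \boldsymbol{\omega}^n_{t,x}=\frac1{m^n_J}\sum_{b\in\{-1,1\}^d}\nu^{n,k}_{i(J,b)}\,b,$$ where $i(J,b)$ is the basic cell in $J$ with center $x^n_J+b/(2n)$ (terms for which no such cell exists are omitted); $\boldsymbol{\pi}^n=\mathcal{L}\otimes\mu\otimes\boldsymbol{\pi}^n_{t,x}$, $\boldsymbol{\omega}^n=\mathcal{L}\otimes\mu\otimes\boldsymbol{\omega}^n_{t,x}$. Scaled cells. $Z=[-1,1]^d$; $S^n_J(x)=n(x-x^n_J)$ on $X^n_J$; $\sigma^n_{t,x}=(S^n_J)_\sharp\mu^n_J/m^n_J$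 with $J=J^n_{t,x}$. Standing assumptions for the limit objects. (A) There are $\boldsymbol{\pi}=\mathcal{L}\otimes\boldsymbol{\pi}_t\in\mathcal{M}_+(\mathbb{R}_+\times X\times Y)$, $\boldsymbol{\pi}_t\in\Pi(\mu,\nu)$ for a.e. $t$, and an infinite $\mathcal{Z}\subset2\mathbb{N}$ with $\int_XW_Y(\boldsymbol{\pi}^n_{t,x},\boldsymbol{\pi}_{t,x})\,d\mu(x)\to0$ as $n\to\infty$ in $\mathcal{Z}$ for a.e. $t$. (B) There is $\sigma\in\mathcal{P}(Z)$ with $\sigma^n_{t,x}\to\sigma$ weak* for $\mathcal{L}\otimes\mu$-a.e. $(t,x)$ and $\sigma(\{z_\ell=0\})=0$ for all $\ell$. Limit momentum. Let $\boldsymbol{\lambda}^n=\mathcal{L}\otimes\mu\otimes\boldsymbol{\lambda}^n_{t,x}$ with $\boldsymbol{\lambda}^n_{t,x}=(S^n_J,\mathrm{id})_\sharp(\pi^{n,k}|_{X^n_J\times Y})/m^n_J$, $k=\lfloor nt\rfloor$, $J=J^n_{t,x}$. Let $\boldsymbol{\lambda}=\mathcal{L}\otimes\mu\otimes\boldsymbol{\lambda}_{t,x}$ be a weak* limit (on $[0,T]\times X\times Z\times Y$ for every $T$) of $\boldsymbol{\lambda}^n$ along an infinite $\hat{\mathcal{Z}}\subset\mathcal{Z}$; its fibers minimize, for a.e. $(t,x)$, the limit fiber problem over $\lambda\in\Pi(\sigma,\boldsymbol{\pi}_{t,x})$ with objective $\int\langle\nabla_Xc(x,y),z\rangle d\lambda+\eta\,\mathrm{KL}(\lambda|\sigma\otimes\boldsymbol{\pi}_{t,x})$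 if $\eta<\infty$ and $\mathrm{KL}(\lambda|\sigma\otimes\boldsymbol{\pi}_{t,x})$ if $\eta=\infty$. The limit momentum is $\boldsymbol{\omega}=\mathcal{L}\otimes\mu\otimes\boldsymbol{\omega}_{t,x}$, $(\boldsymbol{\omega}_{t,x})_\ell=P_Y(\boldsymbol{\lambda}_{t,x}|_{Z^\ell_+\times Y})-P_Y(\boldsymbol{\lambda}_{t,x}|_{Z^\ell_-\times Y})$, $Z^\ell_\pm=\{z\in Z:\pm z_\ell>0\}$. *)

theory Defs
  imports "HOL-Probability.Probability"
begin

text \<open>Every measure on a subset of a Euclidean space is a Borel measure on the whole ambient space
  that is concentrated on that subset.  The dimension is \<open>d = CARD('d)\<close>.\<close>

subsection \<open>Measures\<close>

definition prob_on :: "'a::topological_space set \<Rightarrow> 'a measure \<Rightarrow> bool" where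
  "prob_on S M \<longleftrightarrow> prob_space M \<and> sets M = sets borel \<and> emeasure M (- S) = 0"

definition restr :: "'a measure \<Rightarrow> 'a set \<Rightarrow> 'a measure" where
  "restr M A = density M (indicator A)"

definition msum :: "'i set \<Rightarrow> ('i \<Rightarrow> 'a::topological_space measure) \<Rightarrow> 'a measure" where
  "msum I M = measure_of UNIV (sets borel) (\<lambda>A. \<Sum>i\<in>I. emeasure (M i) A)"

definition couplings :: "'a::topological_space measure \<Rightarrow> 'b::topological_space measure
    \<Rightarrow> ('a \<times> 'b) measure set" where
  "couplings \<alpha> \<beta> = {\<gamma>. sets \<gamma> = sets borel \<and> distr \<gamma> borel fst = \<alpha> \<and> distr \<gamma> borel snd = \<beta>}"

definition kl_phi :: "real \<Rightarrow> real" where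
  "kl_phi s = (if s = 0 then 1 else s * ln s - s + 1)"

definition KL :: "'a measure \<Rightarrow> 'a measure \<Rightarrow> ennreal" where
  "KL \<alpha> \<beta> = (if absolutely_continuous \<beta> \<alpha>
             then \<integral>\<^sup>+ x. ennreal (kl_phi (enn2real (RN_deriv \<beta> \<alpha> x))) \<partial>\<beta> else \<infinity>)"

definition W1 :: "'a::metric_space measure \<Rightarrow> 'a measure \<Rightarrow> ennreal" where
  "W1 \<alpha> \<beta> = (INF \<gamma>\<in>couplings \<alpha> \<beta>. \<integral>\<^sup>+ p. ennreal (dist (fst p) (snd p)) \<partial>\<gamma>)"

text \<open>Weak* convergence of the restrictions to a compact set \<open>S\<close>, in duality with \<open>C(S)\<close>.\<close>

definition weak_star_on :: "'i filter \<Rightarrow> 'a::topological_space set \<Rightarrow> ('i \<Rightarrow> 'a measure) \<Rightarrow> 'a measure \<Rightarrow> bool" where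
  "weak_star_on F S Ms M \<longleftrightarrow> (\<forall>f::'a \<Rightarrow> real. continuous_on S f \<longrightarrow>
     ((\<lambda>n. LINT x:S|Ms n. f x) \<longlongrightarrow> (LINT x:S|M. f x)) F)"

text \<open>\<open>n \<rightarrow> \<infinity>\<close> within an infinite set \<open>N\<close>.\<close>

definition along :: "nat set \<Rightarrow> nat filter" where
  "along N = inf sequentially (principal N)"

text \<open>The measure \<open>M \<otimes> K\<^sub>x\<close> with base measure \<open>M\<close> and fibres \<open>K x\<close>.\<close>

definition fibre_prod :: "'a::topological_space measure \<Rightarrow> ('a \<Rightarrow> 'b::topological_space measure)
    \<Rightarrow> ('a \<times> 'b) measure" where
  "fibre_prod M K = measure_of UNIV (sets borel) (\<lambda>A. \<integral>\<^sup>+ x. emeasure (K x) {y. (x, y) \<in> A} \<partial>M)"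

definition time :: "real measure" where
  "time = restr lborel {0..}"

definition traj_measure :: "'a::topological_space measure \<Rightarrow> (real \<Rightarrow> 'a \<Rightarrow> 'b::topological_space measure)
    \<Rightarrow> (real \<times> 'a \<times> 'b) measure" where
  "traj_measure \<mu> K = fibre_prod time (\<lambda>t. fibre_prod \<mu> (K t))"

subsection \<open>Signed and vector-valued measures\<close>

text \<open>Signed and vector-valued measures are represented by their set functions, evaluated on Borel
  sets only.\<close>

definition abs_cont :: "'a measure \<Rightarrow> ('a set \<Rightarrow> 'v::zero) \<Rightarrow> bool" where
  "abs_cont N w \<longleftrightarrow> (\<forall>A\<in>null_sets N. w A = 0)"

definition is_RN_deriv :: "'a measure \<Rightarrow> ('a set \<Rightarrow> real) \<Rightarrow> ('a \<Rightarrow> real) \<Rightarrow> bool" where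
  "is_RN_deriv N w g \<longleftrightarrow> integrable N g \<and> (\<forall>A\<in>sets N. w A = (LINT y:A|N. g y))"

text \<open>The Radon vector measure \<open>L \<otimes> \<mu> \<otimes> w\<^sub>t\<^sub>,\<^sub>x\<close>.  As time ranges over the half line, its values are
  meaningful on sets of finite total variation only, e.g. on bounded sets and on sets that are
  null for a measure dominating it.\<close>

definition traj_vmeasure :: "'a measure \<Rightarrow> (real \<Rightarrow> 'a \<Rightarrow> 'b set \<Rightarrow> 'v::{banach,second_countable_topology})
    \<Rightarrow> (real \<times> 'a \<times> 'b) set \<Rightarrow> 'v" where
  "traj_vmeasure \<mu> w A = (LINT t|time. LINT x|\<mu>. w t x {y. (t, x, y) \<in> A})"

subsection \<open>Domains and the cost\<close>

definition Xdom :: "(real^'d) set" where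
  "Xdom = {x. \<forall>l. 0 \<le> x $ l \<and> x $ l \<le> 1}"

definition Zdom :: "(real^'d) set" where
  "Zdom = {z. \<forall>l. - 1 \<le> z $ l \<and> z $ l \<le> 1}"

definition twoN :: "nat set" where
  "twoN = {n. even n \<and> n > 0}"

text \<open>Continuous differentiability on a compact set: the function extends to a continuously
  differentiable function on an open neighbourhood.\<close>

definition C1_on :: "'a::real_normed_vector set \<Rightarrow> ('a \<Rightarrow> real) \<Rightarrow> bool" where
  "C1_on S f \<longleftrightarrow> (\<exists>U g g'. open U \<and> S \<subseteq> U \<and> (\<forall>p\<in>S. g p = f p) \<and>
     (\<forall>p\<in>U. (g has_derivative blinfun_apply (g' p)) (at p)) \<and> continuous_on U g')"

definition grad_X :: "((real^'d) \<times> (real^'d) \<Rightarrow> real) \<Rightarrow> real^'d \<Rightarrow> real^'d \<Rightarrow> real^'d" where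
  "grad_X c x y = (THE v. ((\<lambda>x'. c (x', y)) has_derivative (\<lambda>h. v \<bullet> h)) (at x within Xdom))"

subsection \<open>Basic and composite cells\<close>

definition idx :: "nat \<Rightarrow> (nat^'d) set" where
  "idx n = {i. \<forall>l. i $ l < n}"

definition cell :: "nat \<Rightarrow> nat^'d \<Rightarrow> (real^'d) set" where
  "cell n i = {x. \<forall>l. real (i $ l) / n \<le> x $ l \<and> x $ l \<le> real (i $ l) / n + 1 / n}"

definition cell_center :: "nat \<Rightarrow> nat^'d \<Rightarrow> real^'d" where
  "cell_center n i = (\<chi> l. real (i $ l) / n + 1 / (2 * n))"

definition partA :: "nat \<Rightarrow> (nat^'d) set set" where
  "partA n = idx n // {(i, j). i \<in> idx n \<and> j \<in> idx n \<and> (\<forall>l. i $ l div 2 = j $ l div 2)}"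

definition partB :: "nat \<Rightarrow> (nat^'d) set set" where
  "partB n = idx n // {(i, j). i \<in> idx n \<and> j \<in> idx n \<and> (\<forall>l. (i $ l + 1) div 2 = (j $ l + 1) div 2)}"

definition part :: "nat \<Rightarrow> nat \<Rightarrow> (nat^'d) set set" where
  "part n k = (if odd k then partA n else partB n)"

definition ccell :: "nat \<Rightarrow> (nat^'d) set \<Rightarrow> (real^'d) set" where
  "ccell n J = (\<Union>i\<in>J. cell n i)"

text \<open>The centre of a composite cell of \<^term>\<open>part n k\<close>: the coordinates are \<open>m / n\<close> with odd \<open>m\<close> for
  the A partition (\<open>k\<close> odd) and with even \<open>m\<close> for the B partition (\<open>k\<close> even).\<close>

definition ccenter :: "nat \<Rightarrow> nat \<Rightarrow> (nat^'d) set \<Rightarrow> real^'d" where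
  "ccenter n k J = (THE x. x \<in> ccell n J \<and> (\<forall>l. \<exists>m\<le>n. (odd m \<longleftrightarrow> odd k) \<and> x $ l = real m / n))"

definition cmass :: "(real^'d) measure \<Rightarrow> nat \<Rightarrow> (nat^'d) set \<Rightarrow> real" where
  "cmass \<mu> n J = (\<Sum>i\<in>J. measure \<mu> (cell n i))"

definition step :: "nat \<Rightarrow> real \<Rightarrow> nat" where
  "step n t = nat \<lfloor>real n * t\<rfloor>"

text \<open>The choice matters only on cell boundaries.\<close>

definition cell_at :: "nat \<Rightarrow> real \<Rightarrow> real^'d \<Rightarrow> (nat^'d) set" where
  "cell_at n t x = (SOME J. J \<in> part n (step n t) \<and> x \<in> ccell n J)"

definition scaling :: "nat \<Rightarrow> nat \<Rightarrow> (nat^'d) set \<Rightarrow> real^'d \<Rightarrow> real^'d" where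
  "scaling n k J x = real n *\<^sub>R (x - ccenter n k J)"

subsection \<open>Domain decomposition\<close>

text \<open>The product of \<^typ>\<open>ennreal\<close> satisfies \<open>0 * \<infinity> = 0\<close>, as needed for \<open>\<epsilon> = 0\<close>.\<close>

definition cell_objective :: "('a::topological_space \<times> 'b::topological_space \<Rightarrow> real) \<Rightarrow> real
    \<Rightarrow> ('a \<times> 'b) set \<Rightarrow> 'a measure \<Rightarrow> 'b measure \<Rightarrow> ('a \<times> 'b) measure \<Rightarrow> ereal" where
  "cell_objective c \<epsilon> S \<alpha> \<beta> \<pi> =
     ereal (LINT p:S|\<pi>. c p) + enn2ereal (ennreal \<epsilon> * KL \<pi> (\<alpha> \<Otimes>\<^sub>M \<beta>))"

definition Ymarg :: "(real^'d) set \<Rightarrow> ((real^'d) \<times> (real^'d)) measure \<Rightarrow> (real^'d) set \<Rightarrow> (real^'d) measure" where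
  "Ymarg Y \<pi> A = distr (restr \<pi> (A \<times> Y)) borel snd"

text \<open>In the following, \<open>P n k\<close> is the \<open>k\<close>-th iterate at resolution \<open>n\<close>.\<close>

definition disc_traj :: "(real^'d) measure \<Rightarrow> (real^'d) set \<Rightarrow> (nat \<Rightarrow> nat \<Rightarrow> ((real^'d) \<times> (real^'d)) measure)
    \<Rightarrow> nat \<Rightarrow> real \<Rightarrow> real^'d \<Rightarrow> (real^'d) measure" where
  "disc_traj \<mu> Y P n t x = (let J = cell_at n t x in
     scale_measure (ennreal (1 / cmass \<mu> n J)) (msum J (\<lambda>i. Ymarg Y (P n (step n t)) (cell n i))))"

definition disc_mom :: "(real^'d) measure \<Rightarrow> (real^'d) set \<Rightarrow> (nat \<Rightarrow> nat \<Rightarrow> ((real^'d) \<times> (real^'d)) measure)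
    \<Rightarrow> nat \<Rightarrow> real \<Rightarrow> real^'d \<Rightarrow> (real^'d) set \<Rightarrow> real^'d" where
  "disc_mom \<mu> Y P n t x A = (let k = step n t; J = cell_at n t x;
       at_pos = (\<lambda>b i. i \<in> J \<and> cell_center n i = ccenter n k J + (1 / (2 * n)) *\<^sub>R b) in
     (1 / cmass \<mu> n J) *\<^sub>R
       (\<Sum>b | (\<forall>l. b $ l \<in> {- 1, 1}) \<and> (\<exists>i. at_pos b i).
          measure (Ymarg Y (P n k) (cell n (THE i. at_pos b i))) A *\<^sub>R b))"

definition scaled_marg :: "(real^'d) measure \<Rightarrow> (nat \<Rightarrow> (real^'d) measure)
    \<Rightarrow> nat \<Rightarrow> real \<Rightarrow> real^'d \<Rightarrow> (real^'d) measure" where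
  "scaled_marg \<mu> \<mu>n n t x = (let J = cell_at n t x in
     scale_measure (ennreal (1 / cmass \<mu> n J))
       (distr (restr (\<mu>n n) (ccell n J)) borel (scaling n (step n t) J)))"

definition scaled_plan :: "(real^'d) measure \<Rightarrow> (real^'d) set \<Rightarrow> (nat \<Rightarrow> nat \<Rightarrow> ((real^'d) \<times> (real^'d)) measure)
    \<Rightarrow> nat \<Rightarrow> real \<Rightarrow> real^'d \<Rightarrow> ((real^'d) \<times> (real^'d)) measure" where
  "scaled_plan \<mu> Y P n t x = (let k = step n t; J = cell_at n t x in
     scale_measure (ennreal (1 / cmass \<mu> n J))
       (distr (restr (P n k) (ccell n J \<times> Y)) borel (map_prod (scaling n k J) id)))"

subsection \<open>Limit problem and limit momentum\<close>

definition fibre_objective :: "((real^'d) \<times> (real^'d) \<Rightarrow> real) \<Rightarrow> (real^'d) set \<Rightarrow> ennreal \<Rightarrow> real^'d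
    \<Rightarrow> (real^'d) measure \<Rightarrow> (real^'d) measure \<Rightarrow> ((real^'d) \<times> (real^'d)) measure \<Rightarrow> ereal" where
  "fibre_objective c Y \<eta> x \<sigma> \<rho> \<Lambda> =
     (if \<eta> < \<infinity>
      then ereal (LINT p:Zdom \<times> Y|\<Lambda>. grad_X c x (snd p) \<bullet> fst p) + enn2ereal (\<eta> * KL \<Lambda> (\<sigma> \<Otimes>\<^sub>M \<rho>))
      else enn2ereal (KL \<Lambda> (\<sigma> \<Otimes>\<^sub>M \<rho>)))"

definition limit_mom :: "(real^'d) set \<Rightarrow> (real \<Rightarrow> real^'d \<Rightarrow> ((real^'d) \<times> (real^'d)) measure)
    \<Rightarrow> real \<Rightarrow> real^'d \<Rightarrow> (real^'d) set \<Rightarrow> real^'d" where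
  "limit_mom Y \<Lambda> t x A = (\<chi> l.
     measure (Ymarg Y (\<Lambda> t x) {z \<in> Zdom. z $ l > 0}) A -
     measure (Ymarg Y (\<Lambda> t x) {z \<in> Zdom. z $ l < 0}) A)"

end

theory Submission
  imports Defs
begin

text \<open>
  Both densities are bounded because a momentum is a signed rearrangement of the mass that makes up
  the trajectory.  In a composite cell, the fibre \<open>\<pi>\<^sub>t\<^sub>,\<^sub>x\<close> is the normalised sum of the \<open>Y\<close>-marginals of
  the basic cells, and each component of the discrete momentum is the same sum with a sign \<open>\<plusminus>1\<close> in
  front of every summand (some summands may be missing).  In the limit, the two half spaces
  \<open>z\<^sub>l > 0\<close> and \<open>z\<^sub>l < 0\<close> are disjoint, so the two \<open>Y\<close>-marginals that are subtracted add up to at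
  most the full \<open>Y\<close>-marginal of the fibre \<open>\<lambda>\<^sub>t\<^sub>,\<^sub>x\<close>, which is \<open>\<pi>\<^sub>t\<^sub>,\<^sub>x\<close> because \<open>\<lambda>\<^sub>t\<^sub>,\<^sub>x\<close> couples
  \<open>\<sigma>\<close> with \<open>\<pi>\<^sub>t\<^sub>,\<^sub>x\<close>.  Either way \<open>\<bar>\<omega>(A)\<bar> \<le> \<pi>(A)\<close> for every Borel set \<open>A\<close>, where \<open>\<omega>\<close> is a finite
  linear combination of finite measures that are absolutely continuous with respect to \<open>\<pi>\<close>.  The
  lemma \<open>dominated_combination_RN_deriv\<close> turns this into the statement on densities.

  Absolute continuity of the space-time measures is Fubini: a null set of \<open>L \<otimes> \<mu> \<otimes> \<pi>\<^sub>t\<^sub>,\<^sub>x\<close> has null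
  slices for almost every \<open>(t, x)\<close>, and these are also null for \<open>\<omega>\<^sub>t\<^sub>,\<^sub>x\<close>
  (\<open>traj_vmeasure_abs_cont\<close>).  This needs \<open>(t, x) \<mapsto> \<pi>\<^sub>t\<^sub>,\<^sub>x\<close> to be measurable, since only then is
  the fibrewise set function a measure whose null sets carry information.  For the limit this is
  assumed; the discrete fibre depends on \<open>(t, x)\<close> only through the time step and through
  the collection of composite cells that contain \<open>x\<close>, which take countably many values on
  measurable pieces.
\<close>

section \<open>Set functions dominated by a measure\<close>

abbreviation (input) unit_density :: "'a measure \<Rightarrow> ('a set \<Rightarrow> real) \<Rightarrow> bool" where
  "unit_density N w \<equiv> abs_cont N w \<and> (\<exists>g. is_RN_deriv N w g) \<and>
    (\<forall>g. is_RN_deriv N w g \<longrightarrow> (AE y in N. \<bar>g y\<bar> \<le> 1))"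

text \<open>A density of \<open>w\<close> is the combination of the densities of the \<open>M i\<close>.  The averages of
  any density of \<open>w\<close> over sets of positive measure are the quotients \<open>w A / N A\<close>, which lie in the
  closed set \<open>[-1, 1]\<close>; hence so do almost all of its values.\<close>

lemma dominated_combination_RN_deriv:
  fixes N :: "'a measure" and w :: "'a set \<Rightarrow> real"
  assumes N: "finite_measure N" and I: "finite I"
    and M: "\<And>i. i \<in> I \<Longrightarrow> finite_measure (M i)" "\<And>i. i \<in> I \<Longrightarrow> sets (M i) = sets N"
      "\<And>i. i \<in> I \<Longrightarrow> absolutely_continuous N (M i)"
    and w: "\<And>A. A \<in> sets N \<Longrightarrow> w A = (\<Sum>i\<in>I. s i * measure (M i) A)"
    and le: "\<And>A. A \<in> sets N \<Longrightarrow> \<bar>w A\<bar> \<le> measure N A"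
  shows "unit_density N w"
proof (intro conjI allI impI)
  interpret N: finite_measure N by fact
  show "abs_cont N w"
    unfolding abs_cont_def
  proof
    fix A assume A: "A \<in> null_sets N"
    then have "measure N A = 0" "A \<in> sets N" by (auto simp: null_sets_def measure_def)
    with le[of A] show "w A = 0" by simp
  qed
  have "\<exists>D. integrable N D \<and> (\<forall>A\<in>sets N. measure (M i) A = (LINT y:A|N. D y))" if i: "i \<in> I" for i
  proof -
    interpret Mi: finite_measure "M i" using M i by auto
    obtain D where D [measurable]: "D \<in> borel_measurable N"
      and RN: "AE x in N. RN_deriv N (M i) x = ennreal (D x)" and D0: "\<And>x. 0 \<le> D x"
      using N.real_RN_deriv[OF M(1)[OF i] M(3)[OF i] M(2)[OF i]] by metis
    have dens: "M i = density N (\<lambda>x. ennreal (D x))"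
      using N.density_RN_deriv[OF M(3)[OF i] M(2)[OF i]] density_cong[OF _ _ RN] by simp
    have emeas: "emeasure (M i) A = (\<integral>\<^sup>+ x. ennreal (indicator A x * D x) \<partial>N)" if "A \<in> sets N" for A
      unfolding dens using that
      by (subst emeasure_density) (auto intro!: nn_integral_cong simp: indicator_def)
    have "integrable N D"
    proof (rule integrableI_nonneg)
      have "(\<integral>\<^sup>+ x. ennreal (D x) \<partial>N) = emeasure (M i) (space N)"
        by (subst emeas) (auto intro!: nn_integral_cong simp: indicator_def)
      then show "(\<integral>\<^sup>+ x. ennreal (D x) \<partial>N) < \<infinity>"
        using Mi.emeasure_finite[of "space N"] by (simp add: less_top[symmetric])
    qed (use D0 in auto)
    moreover have "measure (M i) A = (LINT y:A|N. D y)" if "A \<in> sets N" for A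
      unfolding measure_def emeas[OF that] set_lebesgue_integral_def using that
      by (subst integral_eq_nn_integral) (auto simp: D0 indicator_def)
    ultimately show ?thesis by blast
  qed
  then obtain D where D: "\<And>i. i \<in> I \<Longrightarrow> integrable N (D i)"
    "\<And>i A. i \<in> I \<Longrightarrow> A \<in> sets N \<Longrightarrow> measure (M i) A = (LINT y:A|N. D i y)"
    by metis
  have "is_RN_deriv N w (\<lambda>y. \<Sum>i\<in>I. s i * D i y)"
    unfolding is_RN_deriv_def
  proof (intro conjI ballI)
    show "integrable N (\<lambda>y. \<Sum>i\<in>I. s i * D i y)" using D by auto
    fix A assume A: "A \<in> sets N"
    have int: "integrable N (\<lambda>y. indicator A y *\<^sub>R D i y)" if "i \<in> I" for i
      using D(1)[OF that] A by (intro integrable_mult_indicator)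
    have "(LINT y:A|N. \<Sum>i\<in>I. s i * D i y) = (\<integral>y. (\<Sum>i\<in>I. s i * (indicator A y *\<^sub>R D i y)) \<partial>N)"
      unfolding set_lebesgue_integral_def
      by (intro Bochner_Integration.integral_cong) (auto simp: sum_distrib_left mult_ac)
    also have "\<dots> = (\<Sum>i\<in>I. s i * (LINT y:A|N. D i y))"
      unfolding set_lebesgue_integral_def using int
      by (subst Bochner_Integration.integral_sum) auto
    finally show "w A = (LINT y:A|N. \<Sum>i\<in>I. s i * D i y)"
      using w[OF A] D(2)[OF _ A] by simp
  qed
  then show "\<exists>g. is_RN_deriv N w g" by blast
  fix g assume g: "is_RN_deriv N w g"
  have "AE y in N. g y \<in> {-1..1}"
  proof (rule N.averaging_theorem)
    fix A assume A: "A \<in> sets N" "measure N A > 0"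
    then have "\<bar>LINT y:A|N. g y\<bar> \<le> measure N A"
      using g le[of A] by (simp add: is_RN_deriv_def)
    with A show "(1 / measure N A) *\<^sub>R (LINT y:A|N. g y) \<in> {-1..1}"
      by (auto simp: abs_le_iff field_simps)
  qed (use g in \<open>auto simp: is_RN_deriv_def\<close>)
  then show "AE y in N. \<bar>g y\<bar> \<le> 1" by eventually_elim auto
qed

section \<open>Sums, marginals and fibre products of measures\<close>

lemma sets_msum [simp, measurable_cong]: "sets (msum I M) = sets borel"
  and space_msum [simp]: "space (msum I M) = UNIV"
  using sets.sigma_sets_eq[of borel] by (auto simp: msum_def sets_measure_of_conv space_measure_of_conv)

lemma emeasure_msum:
  assumes M: "\<And>i. i \<in> I \<Longrightarrow> sets (M i) = sets borel" and A: "A \<in> sets borel"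
  shows "emeasure (msum I M) A = (\<Sum>i\<in>I. emeasure (M i) A)"
proof (rule emeasure_measure_of[OF msum_def])
  show "countably_additive (sets (msum I M)) (\<lambda>A. \<Sum>i\<in>I. emeasure (M i) A)"
  proof (rule countably_additiveI)
    fix F :: "nat \<Rightarrow> _" assume F: "range F \<subseteq> sets (msum I M)" "disjoint_family F"
    have "(\<Sum>n. \<Sum>i\<in>I. emeasure (M i) (F n)) = (\<Sum>i\<in>I. \<Sum>n. emeasure (M i) (F n))"
      by (rule suminf_sum) simp
    also have "\<dots> = (\<Sum>i\<in>I. emeasure (M i) (\<Union> (range F)))"
      using F M by (intro sum.cong refl suminf_emeasure) auto
    finally show "(\<Sum>n. \<Sum>i\<in>I. emeasure (M i) (F n)) = (\<Sum>i\<in>I. emeasure (M i) (\<Union> (range F)))" .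
  qed
qed (use A in \<open>auto simp: positive_def\<close>)

lemma finite_measure_msum:
  assumes "\<And>i. i \<in> I \<Longrightarrow> sets (M i) = sets borel" "\<And>i. i \<in> I \<Longrightarrow> finite_measure (M i)"
  shows "finite_measure (msum I M)"
proof (rule finite_measureI)
  have "emeasure (M i) UNIV \<noteq> \<infinity>" if "i \<in> I" for i
    using assms(2)[OF that] by (simp add: finite_measure.emeasure_finite)
  then show "emeasure (msum I M) (space (msum I M)) \<noteq> \<infinity>"
    using assms(1) by (cases "finite I") (auto simp: emeasure_msum less_top)
qed

lemma finite_measure_scale: "finite_measure M \<Longrightarrow> finite_measure (scale_measure (ennreal r) M)"
  by (intro finite_measureI) (auto simp: finite_measure.emeasure_finite ennreal_mult_eq_top_iff space_scale_measure)

lemma borel_measurable_fst_snd [measurable]: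
  "fst \<in> borel_measurable (borel :: ('a::topological_space \<times> 'b::topological_space) measure)"
  "snd \<in> borel_measurable (borel :: ('a::topological_space \<times> 'b::topological_space) measure)"
  by (intro borel_measurable_continuous_onI continuous_on_fst continuous_on_snd continuous_on_id)+

lemma couplingsD:
  assumes "\<gamma> \<in> couplings \<alpha> \<beta>"
  shows "sets \<gamma> = sets borel" "space \<gamma> = UNIV"
    and "emeasure \<gamma> UNIV = emeasure \<alpha> UNIV"
    and "B \<in> sets borel \<Longrightarrow> emeasure \<gamma> (snd -` B) = emeasure \<beta> B"
proof -
  show s: "sets \<gamma> = sets borel" and sp: "space \<gamma> = UNIV"
    using assms sets_eq_imp_space_eq[of \<gamma> borel] by (auto simp: couplings_def)
  note [measurable_cong] = s
  have "fst \<in> borel_measurable \<gamma>" "snd \<in> borel_measurable \<gamma>" by measurable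
  moreover have "\<alpha> = distr \<gamma> borel fst" "\<beta> = distr \<gamma> borel snd"
    using assms by (auto simp: couplings_def)
  ultimately show "emeasure \<gamma> UNIV = emeasure \<alpha> UNIV"
    "B \<in> sets borel \<Longrightarrow> emeasure \<gamma> (snd -` B) = emeasure \<beta> B"
    using sp by (simp_all add: emeasure_distr)
qed

lemma finite_measure_coupling: "\<gamma> \<in> couplings \<alpha> \<beta> \<Longrightarrow> emeasure \<alpha> UNIV \<noteq> \<infinity> \<Longrightarrow> finite_measure \<gamma>"
  by (intro finite_measureI) (simp add: couplingsD)

lemma sets_Ymarg [simp, measurable_cong]: "sets (Ymarg Y \<pi> S) = sets borel"
  and space_Ymarg [simp]: "space (Ymarg Y \<pi> S) = UNIV"
  by (simp_all add: Ymarg_def)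

lemma sets_borel_Times:
  fixes S :: "'a::second_countable_topology set" and T :: "'b::second_countable_topology set"
  shows "S \<in> sets borel \<Longrightarrow> T \<in> sets borel \<Longrightarrow> S \<times> T \<in> sets borel"
  unfolding borel_prod[symmetric] by (rule pair_measureI)

lemma emeasure_Ymarg:
  assumes [measurable_cong]: "sets \<pi> = sets borel"
    and [measurable]: "S \<in> sets borel" "Y \<in> sets borel" "A \<in> sets borel"
  shows "emeasure (Ymarg Y \<pi> S) A = emeasure \<pi> (S \<times> (Y \<inter> A))"
proof -
  have sp: "space \<pi> = UNIV" using sets_eq_imp_space_eq[OF assms(1)] by simp
  have sets [measurable]: "S \<times> Y \<in> sets \<pi>" "S \<times> (Y \<inter> A) \<in> sets \<pi>"
    using sets_borel_Times[of S Y] sets_borel_Times[of S "Y \<inter> A"] assms by auto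
  have snd: "snd \<in> borel_measurable (restr \<pi> (S \<times> Y))"
    unfolding restr_def by measurable
  have A: "snd -` A \<in> sets \<pi>"
    using measurable_sets[OF borel_measurable_fst_snd(2) assms(4)] assms(1) by simp
  have "emeasure (Ymarg Y \<pi> S) A = emeasure (restr \<pi> (S \<times> Y)) (snd -` A)"
    unfolding Ymarg_def using assms(4) snd by (subst emeasure_distr) (auto simp: restr_def sp)
  also have "\<dots> = (\<integral>\<^sup>+ q. indicator (S \<times> Y) q * indicator (snd -` A) q \<partial>\<pi>)"
    unfolding restr_def using A by (subst emeasure_density) auto
  also have "\<dots> = (\<integral>\<^sup>+ q. indicator (S \<times> (Y \<inter> A)) q \<partial>\<pi>)"
    by (intro nn_integral_cong) (auto simp: indicator_def split: if_splits)
  finally show ?thesis by simp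
qed

lemma finite_measure_Ymarg:
  assumes "finite_measure \<pi>" "sets \<pi> = sets borel" "S \<in> sets borel" "Y \<in> sets borel"
  shows "finite_measure (Ymarg Y \<pi> S)"
  using assms by (intro finite_measureI) (simp add: emeasure_Ymarg finite_measure.emeasure_finite)

lemma sets_fibre_prod [simp, measurable_cong]: "sets (fibre_prod M K) = sets borel"
  and space_fibre_prod [simp]: "space (fibre_prod M K) = UNIV"
  using sets.sigma_sets_eq[of borel] by (auto simp: fibre_prod_def sets_measure_of_conv space_measure_of_conv)

lemma sets_borel_slice:
  fixes A :: "('a::second_countable_topology \<times> 'b::second_countable_topology) set"
  assumes "A \<in> sets borel"
  shows "{y. (x, y) \<in> A} \<in> sets borel"
  using sets_Pair1[of A borel borel x] assms unfolding borel_prod by (simp add: vimage_def)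

lemma sets_borel_reassoc:
  fixes A :: "('a::second_countable_topology \<times> 'b::second_countable_topology \<times> 'c::second_countable_topology) set"
  assumes "A \<in> sets borel"
  shows "(\<lambda>q. (fst (fst q), snd (fst q), snd q)) -` A \<in> sets (borel \<Otimes>\<^sub>M borel)"
proof -
  have "(\<lambda>q. (fst (fst q), snd (fst q), snd q)) \<in> borel \<rightarrow>\<^sub>M (borel :: ('a \<times> 'b \<times> 'c) measure)"
    by (intro borel_measurable_continuous_onI continuous_intros)
  from measurable_sets[OF this assms] show ?thesis by (subst borel_prod) simp
qed

lemma emeasure_fibre_prod:
  fixes K :: "'a::second_countable_topology \<Rightarrow> 'b::second_countable_topology measure"
  assumes K: "\<And>x. sets (K x) = sets borel"
    and meas: "\<And>A. A \<in> sets borel \<Longrightarrow> (\<lambda>x. emeasure (K x) {y. (x, y) \<in> A}) \<in> borel_measurable M"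
    and A: "A \<in> sets borel"
  shows "emeasure (fibre_prod M K) A = (\<integral>\<^sup>+ x. emeasure (K x) {y. (x, y) \<in> A} \<partial>M)"
proof (rule emeasure_measure_of[OF fibre_prod_def])
  let ?e = "\<lambda>A. \<integral>\<^sup>+ x. emeasure (K x) {y. (x, y) \<in> A} \<partial>M"
  show "countably_additive (sets (fibre_prod M K)) ?e"
  proof (rule countably_additiveI)
    fix F :: "nat \<Rightarrow> _" assume F: "range F \<subseteq> sets (fibre_prod M K)" "disjoint_family F"
    then have Fb: "F n \<in> sets borel" for n by auto
    have "(\<Sum>n. ?e (F n)) = (\<integral>\<^sup>+ x. (\<Sum>n. emeasure (K x) {y. (x, y) \<in> F n}) \<partial>M)"
      using Fb meas by (intro nn_integral_suminf[symmetric]) auto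
    also have "\<dots> = ?e (\<Union> (range F))"
    proof (intro nn_integral_cong)
      fix x
      have "(\<Sum>n. emeasure (K x) {y. (x, y) \<in> F n}) = emeasure (K x) (\<Union>n. {y. (x, y) \<in> F n})"
        using F(2) sets_borel_slice[OF Fb]
        by (intro suminf_emeasure) (auto simp: K disjoint_family_on_def)
      also have "(\<Union>n. {y. (x, y) \<in> F n}) = {y. (x, y) \<in> \<Union> (range F)}" by auto
      finally show "(\<Sum>n. emeasure (K x) {y. (x, y) \<in> F n}) = emeasure (K x) {y. (x, y) \<in> \<Union> (range F)}" .
    qed
    finally show "(\<Sum>n. ?e (F n)) = ?e (\<Union> (range F))" .
  qed
qed (use A in \<open>auto simp: positive_def\<close>)

section \<open>Absolute continuity in space-time\<close>

lemma sets_time [simp, measurable_cong]: "sets time = sets borel"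
  by (simp add: time_def restr_def)

lemma space_time [simp]: "space time = UNIV"
  by (simp add: time_def restr_def)

lemma sigma_finite_time: "sigma_finite_measure time"
  unfolding time_def restr_def
  by (subst sigma_finite_measure.sigma_finite_iff_density_finite[OF sigma_finite_lborel]) (auto simp: indicator_def)

lemma traj_vmeasure_abs_cont:
  fixes \<mu> :: "'a::second_countable_topology measure"
    and K :: "real \<Rightarrow> 'a \<Rightarrow> 'b::second_countable_topology measure"
    and w :: "real \<Rightarrow> 'a \<Rightarrow> 'b set \<Rightarrow> real^'n"
  assumes mu: "sigma_finite_measure \<mu>" "sets \<mu> = sets borel"
    and K: "\<And>t x. sets (K t x) = sets borel"
    and meas: "\<And>A. A \<in> sets borel \<Longrightarrow>
      (\<lambda>(t, x). emeasure (K t x) {y. (t, x, y) \<in> A}) \<in> borel_measurable borel"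
    and ac: "AE t in time. AE x in \<mu>. \<forall>l. abs_cont (K t x) (\<lambda>A. w t x A $ l)"
  shows "abs_cont (traj_measure \<mu> K) (traj_vmeasure \<mu> w)"
  unfolding abs_cont_def
proof
  interpret sigma_finite_measure \<mu> by fact
  note [measurable_cong] = mu(2)
  have meas_pair: "(\<lambda>(t, x). emeasure (K t x) {y. (t, x, y) \<in> A}) \<in> borel_measurable (borel \<Otimes>\<^sub>M \<mu>)"
    if "A \<in> sets borel" for A
    using meas[OF that] sets_pair_measure_cong[OF refl mu(2), of borel] unfolding borel_prod[symmetric]
    by (simp cong: measurable_cong_sets)
  have inner_meas: "(\<lambda>x. emeasure (K t x) {y. (x, y) \<in> B}) \<in> borel_measurable \<mu>"
    if B: "B \<in> sets borel" for t B
  proof -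
    have "UNIV \<times> B \<in> sets (borel :: (real \<times> 'a \<times> 'b) measure)"
      using B by (intro sets_borel_Times) auto
    from measurable_Pair2[OF meas_pair[OF this], of t] show ?thesis by simp
  qed
  have inner: "emeasure (fibre_prod \<mu> (K t)) B = (\<integral>\<^sup>+ x. emeasure (K t x) {y. (x, y) \<in> B} \<partial>\<mu>)"
    if "B \<in> sets borel" for t B
    using that K inner_meas by (intro emeasure_fibre_prod)
  have slice: "{q. (t, q) \<in> A} \<in> sets borel" if "A \<in> sets borel" for t and A :: "(real \<times> 'a \<times> 'b) set"
    using sets_borel_slice[OF that] .
  have outer_meas: "(\<lambda>t. emeasure (fibre_prod \<mu> (K t)) {q. (t, q) \<in> A}) \<in> borel_measurable time"
    if A: "A \<in> sets borel" for A
    using borel_measurable_nn_integral[OF meas_pair[OF A]] inner[OF slice[OF A]]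
    by (simp cong: measurable_cong_sets)
  fix A assume A0: "A \<in> null_sets (traj_measure \<mu> K)"
  then have A: "A \<in> sets borel" by (auto simp: traj_measure_def)
  have "(\<integral>\<^sup>+ t. emeasure (fibre_prod \<mu> (K t)) {q. (t, q) \<in> A} \<partial>time) = 0"
    using A0 unfolding traj_measure_def
    by (subst emeasure_fibre_prod[symmetric]) (auto intro!: outer_meas simp: A null_sets_def)
  then have null: "AE t in time. emeasure (fibre_prod \<mu> (K t)) {q. (t, q) \<in> A} = 0"
    by (subst (asm) nn_integral_0_iff_AE[OF outer_meas[OF A]]) simp
  have "AE t in time. (LINT x|\<mu>. w t x {y. (t, x, y) \<in> A}) = 0"
    using null ac
  proof eventually_elim
    case (elim t)
    have "(\<integral>\<^sup>+ x. emeasure (K t x) {y. (x, y) \<in> {q. (t, q) \<in> A}} \<partial>\<mu>) = 0"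
      using elim(1) unfolding inner[OF slice[OF A]] .
    then have "AE x in \<mu>. emeasure (K t x) {y. (x, y) \<in> {q. (t, q) \<in> A}} = 0"
      by (subst (asm) nn_integral_0_iff_AE[OF inner_meas[OF slice[OF A]]])
    with elim(2) have "AE x in \<mu>. w t x {y. (t, x, y) \<in> A} = 0"
    proof eventually_elim
      case (elim x)
      have "{y. (t, x, y) \<in> A} \<in> sets borel"
        using sets_borel_slice[OF slice[OF A], of x] by simp
      with elim(2) have "{y. (t, x, y) \<in> A} \<in> null_sets (K t x)" by (auto simp: null_sets_def K)
      with elim(1) show ?case by (auto simp: abs_cont_def vec_eq_iff)
    qed
    then show ?case by (rule integral_eq_zero_AE)
  qed
  then show "traj_vmeasure \<mu> w A = 0"
    unfolding traj_vmeasure_def by (rule integral_eq_zero_AE)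
qed

section \<open>Cells\<close>

lemma closed_box: "closed {x :: real^'d. \<forall>l. a l \<le> x $ l \<and> x $ l \<le> b l}"
proof -
  have "{x :: real^'d. \<forall>l. a l \<le> x $ l \<and> x $ l \<le> b l}
      = (\<Inter>l. {x. a l \<le> x $ l} \<inter> {x. x $ l \<le> b l})" by auto
  also have "closed \<dots>"
    by (intro closed_INT ballI closed_Int closed_Collect_le continuous_intros)
  finally show ?thesis .
qed

lemma borel_cell [simp]: "cell n i \<in> sets borel"
  and borel_Xdom: "Xdom \<in> sets borel"
  and borel_Zdom: "Zdom \<in> sets borel"
  unfolding cell_def Xdom_def Zdom_def by (intro borel_closed closed_box)+

lemma finite_idx: "finite (idx n :: (nat^'d) set)"
proof -
  have "idx n \<subseteq> vec_lambda ` (UNIV \<rightarrow>\<^sub>E {..<n} :: ('d \<Rightarrow> nat) set)"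
  proof
    fix i :: "nat^'d" assume "i \<in> idx n"
    then have "vec_nth i \<in> UNIV \<rightarrow>\<^sub>E {..<n}" by (auto simp: idx_def)
    then show "i \<in> vec_lambda ` (UNIV \<rightarrow>\<^sub>E {..<n})" by (metis imageI vec_nth_inverse)
  qed
  then show ?thesis by (rule finite_subset) (intro finite_imageI finite_PiE, auto)
qed

lemma part_subset_Pow: "part n k \<subseteq> Pow (idx n)"
  by (auto simp: part_def partA_def partB_def quotient_def)

lemma Union_part: "\<Union> (part n k) = idx n"
  by (auto simp: part_def partA_def partB_def quotient_def)

lemma borel_ccell: "J \<in> part n k \<Longrightarrow> ccell n J \<in> sets borel"
  using part_subset_Pow[of n k] finite_subset[OF _ finite_idx, of J n]
  unfolding ccell_def by (intro sets.finite_UN) auto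

lemma Xdom_covered:
  assumes n: "n > 0" and x: "x \<in> Xdom"
  shows "\<exists>i\<in>idx n. x \<in> cell n i"
proof
  \<comment> \<open>the cap at \<open>n - 1\<close> assigns the right boundary to the last cell\<close>
  define i where "i = (\<chi> l. min (n - 1) (nat \<lfloor>n * x $ l\<rfloor>))"
  show "i \<in> idx n" using n by (auto simp: i_def idx_def min_def)
  have "real (i $ l) \<le> n * x $ l \<and> n * x $ l \<le> real (i $ l) + 1" for l
  proof -
    have x01: "0 \<le> x $ l" "x $ l \<le> 1" using x by (auto simp: Xdom_def)
    then have "0 \<le> n * x $ l" "n * x $ l \<le> n" using n by (auto simp: mult_left_le)
    then show ?thesis using n unfolding i_def
      by (cases "nat \<lfloor>n * x $ l\<rfloor> \<le> n - 1") (auto simp: min_def, linarith+)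
  qed
  then show "x \<in> cell n i" using n by (auto simp: cell_def field_simps)
qed

lemma cell_at:
  assumes "n > 0" "x \<in> Xdom"
  shows "cell_at n t x \<in> part n (step n t)" "x \<in> ccell n (cell_at n t x)"
proof -
  obtain i where "i \<in> idx n" "x \<in> cell n i" using Xdom_covered[OF assms] by auto
  then have "\<exists>J. J \<in> part n (step n t) \<and> x \<in> ccell n J"
    using Union_part[of n "step n t"] by (auto simp: ccell_def)
  from someI_ex[OF this] show "cell_at n t x \<in> part n (step n t)" "x \<in> ccell n (cell_at n t x)"
    by (auto simp: cell_at_def)
qed

lemma cell_center_inject: "n > 0 \<Longrightarrow> cell_center n i = cell_center n j \<longleftrightarrow> i = j"
  by (auto simp: cell_center_def vec_eq_iff field_simps)

section \<open>The discrete momentum\<close>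

lemma emeasure_disc_traj:
  assumes "A \<in> sets borel"
  shows "emeasure (disc_traj \<mu> Y P n t x) A = ennreal (1 / cmass \<mu> n (cell_at n t x)) *
    (\<Sum>i\<in>cell_at n t x. emeasure (Ymarg Y (P n (step n t)) (cell n i)) A)"
  using assms by (simp add: disc_traj_def Let_def emeasure_msum)

lemma sets_disc_traj [simp]: "sets (disc_traj \<mu> Y P n t x) = sets borel"
  by (simp add: disc_traj_def Let_def)

lemma finite_measure_disc_traj:
  assumes "finite_measure (P n (step n t))" "sets (P n (step n t)) = sets borel" "Y \<in> sets borel"
  shows "finite_measure (disc_traj \<mu> Y P n t x)"
  unfolding disc_traj_def Let_def using assms
  by (intro finite_measure_scale finite_measure_msum finite_measure_Ymarg) auto

text \<open>A sign vector \<open>b\<close> determines its cell in \<open>J\<close>, and conversely a cell determines \<open>b\<close>, as a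
  multiple of the offset between the centres of the cell and of \<open>J\<close>.  So every cell of \<open>J\<close> enters the
  momentum at most once, with coefficients \<open>\<plusminus>1\<close>.\<close>

lemma disc_mom_RN_deriv:
  fixes \<mu> :: "(real^'d) measure"
  assumes n: "n > 0" and x: "x \<in> Xdom"
    and pos: "\<And>i. i \<in> idx n \<Longrightarrow> measure \<mu> (cell n i) > 0"
    and P: "finite_measure (P n (step n t))" "sets (P n (step n t)) = sets borel"
    and Y: "Y \<in> sets borel"
  shows "unit_density (disc_traj \<mu> Y P n t x) (\<lambda>A. disc_mom \<mu> Y P n t x A $ l)"
proof -
  define k J r where "k = step n t" and "J = cell_at n t x" and "r = 1 / cmass \<mu> n J"
  define at_pos :: "real^'d \<Rightarrow> nat^'d \<Rightarrow> bool"
    where "at_pos b i \<longleftrightarrow> i \<in> J \<and> cell_center n i = ccenter n k J + (1 / (2 * n)) *\<^sub>R b" for b i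
  define B where "B = {b. (\<forall>l. b $ l \<in> {- 1, 1}) \<and> (\<exists>i. at_pos b i)}"
  define \<iota> where "\<iota> b = (THE i. at_pos b i)" for b
  define M where "M i = Ymarg Y (P n k) (cell n i)" for i
  let ?N = "disc_traj \<mu> Y P n t x"
  have J: "J \<subseteq> idx n" "J \<noteq> {}"
    using cell_at[OF n x, of t] part_subset_Pow by (auto simp: J_def ccell_def)
  then have finJ: "finite J" using finite_subset[OF _ finite_idx] by blast
  have "cmass \<mu> n J > 0"
    unfolding cmass_def using J finJ pos by (intro sum_pos) auto
  then have r: "r > 0" by (simp add: r_def)
  have at_pos_\<iota>: "at_pos b (\<iota> b)" if "b \<in> B" for b
  proof -
    have "\<exists>i. at_pos b i" using that by (simp add: B_def)
    moreover have "i = j" if "at_pos b i" "at_pos b j" for i j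
    proof -
      have "cell_center n i = cell_center n j" using that by (simp add: at_pos_def)
      then show ?thesis by (simp add: cell_center_inject[OF n])
    qed
    ultimately have "\<exists>!i. at_pos b i" by (rule ex_ex1I)
    then show ?thesis unfolding \<iota>_def by (rule theI')
  qed
  have inj: "inj_on \<iota> B"
  proof
    fix a b assume "a \<in> B" "b \<in> B" "\<iota> a = \<iota> b"
    then have "(1 / (2 * real n)) *\<^sub>R a = (1 / (2 * real n)) *\<^sub>R b"
      using at_pos_\<iota>[of a] at_pos_\<iota>[of b] by (simp add: at_pos_def)
    then show "a = b" using n by simp
  qed
  have sub: "\<iota> ` B \<subseteq> J" using at_pos_\<iota> by (auto simp: at_pos_def)
  then have finB: "finite B" using inj finJ finite_imageD finite_subset by blast
  have setsM: "sets (M i) = sets borel" for i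
    by (simp add: M_def)
  have finM: "finite_measure (M i)" for i
    unfolding M_def k_def using P Y by (intro finite_measure_Ymarg) auto
  have traj: "measure ?N A = r * (\<Sum>i\<in>J. measure (M i) A)" if "A \<in> sets borel" for A
  proof -
    have "emeasure ?N A = ennreal r * (\<Sum>i\<in>J. emeasure (M i) A)"
      unfolding r_def M_def k_def J_def using that by (rule emeasure_disc_traj)
    also have "\<dots> = ennreal (r * (\<Sum>i\<in>J. measure (M i) A))"
      using r finite_measure.emeasure_eq_measure[OF finM]
      by (simp add: ennreal_mult sum_nonneg)
    finally show ?thesis using r by (simp add: measure_def sum_nonneg)
  qed
  have mom: "disc_mom \<mu> Y P n t x A $ l = (\<Sum>b\<in>B. r * b $ l * measure (M (\<iota> b)) A)" for A
    unfolding disc_mom_def Let_def B_def \<iota>_def at_pos_def M_def r_def J_def k_def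
    by (simp add: sum_component sum_distrib_left mult_ac)
  have le: "(\<Sum>b\<in>B. measure (M (\<iota> b)) A) \<le> (\<Sum>i\<in>J. measure (M i) A)" for A
    using sum_mono2[OF finJ sub, of "\<lambda>i. measure (M i) A"]
    by (simp add: sum.reindex[OF inj] comp_def)
  show ?thesis
  proof (rule dominated_combination_RN_deriv)
    show "finite_measure ?N" using P Y by (rule finite_measure_disc_traj)
    show "finite B" by fact
    show "finite_measure (M (\<iota> b))" "sets (M (\<iota> b)) = sets ?N" for b
      using finM by (auto simp: M_def)
    show "absolutely_continuous ?N (M (\<iota> b))" if b: "b \<in> B" for b
      unfolding absolutely_continuous_def
    proof
      fix A assume A: "A \<in> null_sets ?N"
      then have "measure ?N A = 0" "A \<in> sets borel"
        by (auto simp: null_sets_def measure_def)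
      then have "(\<Sum>i\<in>J. measure (M i) A) = 0" using traj r by auto
      then have "measure (M (\<iota> b)) A = 0"
        using sum_nonneg_eq_0_iff[OF finJ, of "\<lambda>i. measure (M i) A"] sub b by auto
      with \<open>A \<in> sets borel\<close> show "A \<in> null_sets (M (\<iota> b))"
        by (auto simp: null_sets_def finite_measure.emeasure_eq_measure[OF finM] setsM)
    qed
    show "disc_mom \<mu> Y P n t x A $ l = (\<Sum>b\<in>B. r * b $ l * measure (M (\<iota> b)) A)" for A
      by (rule mom)
    fix A assume "A \<in> sets ?N"
    then have A: "A \<in> sets borel" by simp
    have "\<bar>disc_mom \<mu> Y P n t x A $ l\<bar> \<le> (\<Sum>b\<in>B. \<bar>r * b $ l * measure (M (\<iota> b)) A\<bar>)"
      unfolding mom by (rule sum_abs)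
    also have "\<dots> = r * (\<Sum>b\<in>B. measure (M (\<iota> b)) A)"
    proof -
      have "\<bar>b $ l\<bar> = 1" if "b \<in> B" for b
      proof -
        have "b $ l \<in> {- 1, 1}" using that unfolding B_def by blast
        then show ?thesis by auto
      qed
      then show ?thesis using r by (simp add: abs_mult sum_distrib_left)
    qed
    also have "\<dots> \<le> measure ?N A" using le r by (simp add: traj[OF A])
    finally show "\<bar>disc_mom \<mu> Y P n t x A $ l\<bar> \<le> measure ?N A" .
  qed
qed

text \<open>The fibre is selected by the pair of the time step and the collection of all composite cells
  that contain \<open>x\<close>; cell boundaries, where the collection has several members, need no separate
  treatment.\<close>

lemma measurable_disc_traj:
  fixes \<mu> :: "(real^'d) measure"
  assumes P: "\<And>k. finite_measure (P n k)" "\<And>k. sets (P n k) = sets borel"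
    and Y: "Y \<in> sets borel" and A: "A \<in> sets borel"
  shows "(\<lambda>(t, x). emeasure (disc_traj \<mu> Y P n t x) {y. (t, x, y) \<in> A}) \<in> borel_measurable borel"
proof -
  define covers where "covers k x = {J \<in> part n k. x \<in> ccell n J}" for k and x :: "real^'d"
  define sel where "sel = (\<lambda>(t, x). (step n t, covers (step n t) x))"
  define D where "D = (\<lambda>(k, S). let J = (SOME J. J \<in> S) in
     scale_measure (ennreal (1 / cmass \<mu> n J)) (msum J (\<lambda>i. Ymarg Y (P n k) (cell n i))))"
  let ?I = "UNIV \<times> Pow (Pow (idx n)) :: (nat \<times> (nat^'d) set set) set"
  have I: "countable ?I"
    by (intro countable_SIGMA countableI_type countable_finite) (auto simp: finite_idx)
  have D_sets: "sets (D a) = sets borel" for a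
    by (simp add: D_def Let_def split: prod.split)
  have D_finite: "finite_measure (D a)" for a
    unfolding D_def Let_def using P Y
    by (auto split: prod.split intro!: finite_measure_scale finite_measure_msum finite_measure_Ymarg)
  have eq: "disc_traj \<mu> Y P n t x = D (sel (t, x))" for t x
    by (simp add: disc_traj_def D_def sel_def covers_def cell_at_def Let_def)
  have step_meas: "step n \<in> borel \<rightarrow>\<^sub>M count_space UNIV"
    unfolding step_def[abs_def] by measurable
  have sel: "sel \<in> borel \<rightarrow>\<^sub>M count_space ?I"
  proof (subst measurable_count_space_eq_countable[OF I], intro conjI ballI)
    show "sel \<in> space borel \<rightarrow> ?I"
      using part_subset_Pow by (fastforce simp: sel_def covers_def)
    fix a :: "nat \<times> (nat^'d) set set" assume "a \<in> ?I"
    then obtain k S where a: "a = (k, S)" "S \<subseteq> Pow (idx n)" by auto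
    have S_iff: "covers k x = S \<longleftrightarrow> (\<forall>J\<in>Pow (idx n). (J \<in> part n k \<and> x \<in> ccell n J) = (J \<in> S))" for x
      using a(2) part_subset_Pow[of n k] unfolding covers_def by blast
    have "covers k -` {S} = (\<Inter>J\<in>Pow (idx n). {x. (J \<in> part n k \<and> x \<in> ccell n J) = (J \<in> S)})"
      unfolding vimage_def by (auto simp only: S_iff singleton_iff)
    also have "\<dots> \<in> sets borel"
    proof (intro sets.finite_INT)
      show "{x. (J \<in> part n k \<and> x \<in> ccell n J) = (J \<in> S)} \<in> sets borel" for J
      proof (cases "J \<in> part n k")
        case True
        show ?thesis
          using borel_ccell[OF True] borel_comp[OF borel_ccell[OF True]] True
          by (cases "J \<in> S") (simp_all add: Compl_eq)
      qed simp
    qed (auto simp: finite_idx)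
    finally have "step n -` {k} \<times> covers k -` {S} \<in> sets borel"
      using measurable_sets[OF step_meas, of "{k}"] by (intro sets_borel_Times) auto
    also have "step n -` {k} \<times> covers k -` {S} = sel -` {a} \<inter> space borel"
      by (auto simp: sel_def a)
    finally show "sel -` {a} \<inter> space borel \<in> sets borel" .
  qed
  have "(\<lambda>q. emeasure (D a) {y. (fst q, snd q, y) \<in> A}) \<in> borel_measurable borel" for a
  proof -
    interpret finite_measure "D a" by (rule D_finite)
    have "(\<lambda>q. (fst (fst q), snd (fst q), snd q)) -` A \<in> sets (borel \<Otimes>\<^sub>M D a)"
      using sets_borel_reassoc[OF A]
      by (simp add: sets_pair_measure_cong[OF refl D_sets])
    from measurable_emeasure_Pair[OF this] show ?thesis by (simp add: vimage_def)
  qed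
  from measurable_compose_countable'[OF this sel I]
  show ?thesis unfolding eq by (simp add: case_prod_unfold)
qed

section \<open>Finiteness of the iterates\<close>

text \<open>A coupling has the total mass of its first marginal, so each cell problem only has finite
  competitors, whatever the previous iterate is.\<close>

lemma iterate_finite:
  assumes Q: "P n 0 \<in> couplings (\<mu>n n) (\<nu>n n)" and mun: "prob_on Xdom (\<mu>n n)"
    and P_sum: "\<And>k. k \<ge> 1 \<Longrightarrow> P n k = msum (part n k) (PJ n k)"
    and PJ: "\<And>k J. k \<ge> 1 \<Longrightarrow> J \<in> part n k \<Longrightarrow>
      PJ n k J \<in> couplings (restr (\<mu>n n) (ccell n J)) (Ymarg Y (P n (k - 1)) (ccell n J))"
  shows "sets (P n k) = sets borel \<and> finite_measure (P n k)"
proof (cases "k = 0")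
  case True
  interpret prob_space "\<mu>n n" using mun by (simp add: prob_on_def)
  show ?thesis using couplingsD(1)[OF Q] finite_measure_coupling[OF Q] True by simp
next
  case False
  interpret prob_space "\<mu>n n" using mun by (simp add: prob_on_def)
  have [simp]: "sets (\<mu>n n) = sets borel" "space (\<mu>n n) = UNIV"
    using mun sets_eq_imp_space_eq[of "\<mu>n n" borel] by (auto simp: prob_on_def)
  have "sets (PJ n k J) = sets borel \<and> finite_measure (PJ n k J)" if J: "J \<in> part n k" for J
  proof -
    have "ccell n J \<in> sets (\<mu>n n)" using borel_ccell[OF J] by simp
    then have "emeasure (restr (\<mu>n n) (ccell n J)) UNIV = emeasure (\<mu>n n) (ccell n J)"
      unfolding restr_def by (subst emeasure_density) (auto intro!: borel_measurable_indicator)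
    then have "emeasure (restr (\<mu>n n) (ccell n J)) UNIV \<noteq> \<infinity>"
      using emeasure_finite[of "ccell n J"] by simp
    moreover have "PJ n k J \<in> couplings (restr (\<mu>n n) (ccell n J)) (Ymarg Y (P n (k - 1)) (ccell n J))"
      using PJ[OF _ J] False by simp
    ultimately show ?thesis using couplingsD(1) finite_measure_coupling by blast
  qed
  then show ?thesis using P_sum[of k] False by (auto intro!: finite_measure_msum)
qed

section \<open>The limit momentum\<close>

text \<open>The momentum is the combination with coefficients \<open>\<plusminus>1\<close> of the \<open>Y\<close>-marginals over the two open
  half spaces; disjointness of these bounds the sum of the two marginals by \<open>N\<close>.\<close>

lemma limit_mom_RN_deriv:
  fixes \<Lambda> :: "real \<Rightarrow> real^'d \<Rightarrow> ((real^'d) \<times> (real^'d)) measure"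
  assumes \<Lambda>: "\<Lambda> t x \<in> couplings \<sigma> N" and \<sigma>: "emeasure \<sigma> UNIV \<noteq> \<infinity>"
    and N: "finite_measure N" "sets N = sets borel" and Y: "Y \<in> sets borel"
  shows "unit_density N (\<lambda>A. limit_mom Y \<Lambda> t x A $ l)"
proof -
  interpret N: finite_measure N by (rule N)
  define H where "H s = {z :: real^'d. z \<in> Zdom \<and> s * z $ l > 0}" for s :: real
  define M where "M s = Ymarg Y (\<Lambda> t x) (H s)" for s
  note \<Lambda>_sets = couplingsD(1)[OF \<Lambda>]
  have "finite_measure (\<Lambda> t x)" using \<Lambda> \<sigma> by (rule finite_measure_coupling)
  then interpret L: finite_measure "\<Lambda> t x" .
  have "open {z :: real^'d. s * z $ l > 0}" for s
    by (intro open_Collect_less continuous_intros)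
  then have H: "H s \<in> sets borel" for s
    using borel_Zdom by (auto simp: H_def Collect_conj_eq)
  have setsM: "sets (M i) = sets borel" for i
    by (simp add: M_def)
  have finM: "finite_measure (M s)" for s
    unfolding M_def using \<Lambda>_sets H Y L.finite_measure_axioms by (intro finite_measure_Ymarg)
  have sum_le: "measure (M 1) A + measure (M (- 1)) A \<le> measure N A" if A: "A \<in> sets borel" for A
  proof -
    have s: "H s \<times> (Y \<inter> A) \<in> sets (\<Lambda> t x)" for s
      using sets_borel_Times[OF H, of "Y \<inter> A"] Y A \<Lambda>_sets by auto
    have "measure (M 1) A + measure (M (- 1)) A
        = measure (\<Lambda> t x) (H 1 \<times> (Y \<inter> A)) + measure (\<Lambda> t x) (H (- 1) \<times> (Y \<inter> A))"
      using emeasure_Ymarg[OF \<Lambda>_sets H Y A] by (simp add: M_def measure_def)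
    also have "\<dots> = measure (\<Lambda> t x) (H 1 \<times> (Y \<inter> A) \<union> H (- 1) \<times> (Y \<inter> A))"
      by (intro L.finite_measure_Union[symmetric] s) (auto simp: H_def)
    also have "\<dots> \<le> measure (\<Lambda> t x) (snd -` A)"
      using sets_borel_Times[of UNIV A] A
      by (intro L.finite_measure_mono) (auto simp: \<Lambda>_sets vimage_snd)
    also have "\<dots> = measure N A" using couplingsD(4)[OF \<Lambda> A] by (simp add: measure_def)
    finally show ?thesis .
  qed
  have mom: "limit_mom Y \<Lambda> t x A $ l = (\<Sum>s\<in>{1, - 1}. s * measure (M s) A)" for A
    by (simp add: limit_mom_def M_def H_def)
  show ?thesis
  proof (rule dominated_combination_RN_deriv)
    show "absolutely_continuous N (M s)" if "s \<in> {1, - 1}" for s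
      unfolding absolutely_continuous_def
    proof
      fix A assume A: "A \<in> null_sets N"
      then have "measure N A = 0" "A \<in> sets borel" using N by (auto simp: null_sets_def measure_def)
      then have "measure (M s) A = 0"
        using sum_le[of A] that measure_nonneg[of "M 1" A] measure_nonneg[of "M (- 1)" A]
        by (elim insertE emptyE; simp only:; linarith)
      with \<open>A \<in> sets borel\<close> show "A \<in> null_sets (M s)"
        by (auto simp: null_sets_def finite_measure.emeasure_eq_measure[OF finM] setsM)
    qed
    show "limit_mom Y \<Lambda> t x A $ l = (\<Sum>s\<in>{1, - 1}. s * measure (M s) A)" for A by (rule mom)
    show "\<bar>limit_mom Y \<Lambda> t x A $ l\<bar> \<le> measure N A" if "A \<in> sets N" for A
    proof -
      have "measure (M 1) A + measure (M (- 1)) A \<le> measure N A"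
        using sum_le[of A] that N by simp
      with measure_nonneg[of "M 1" A] measure_nonneg[of "M (- 1)" A] show ?thesis
        unfolding mom by (simp add: abs_le_iff, linarith)
    qed
  qed (use N finM in \<open>auto simp: M_def\<close>)
qed

theorem proposition5p20:
  fixes Y :: "(real^'d) set"
    and \<mu> \<nu> :: "(real^'d) measure"
    and c :: "(real^'d) \<times> (real^'d) \<Rightarrow> real"
    and \<pi>init :: "((real^'d) \<times> (real^'d)) measure"
    and \<mu>n \<nu>n :: "nat \<Rightarrow> (real^'d) measure"
    and \<pi>ninit :: "nat \<Rightarrow> ((real^'d) \<times> (real^'d)) measure"
    and cn f :: "nat \<Rightarrow> (real^'d) \<times> (real^'d) \<Rightarrow> real"
    and \<epsilon> :: "nat \<Rightarrow> real"
    and \<eta> :: ennreal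
    and P :: "nat \<Rightarrow> nat \<Rightarrow> ((real^'d) \<times> (real^'d)) measure"
    and PJ :: "nat \<Rightarrow> nat \<Rightarrow> (nat^'d) set \<Rightarrow> ((real^'d) \<times> (real^'d)) measure"
    and N N' :: "nat set"
    and p :: "real \<Rightarrow> real^'d \<Rightarrow> (real^'d) measure"
    and \<sigma> :: "(real^'d) measure"
    and \<Lambda> :: "real \<Rightarrow> real^'d \<Rightarrow> ((real^'d) \<times> (real^'d)) measure"
  \<comment> \<open>problem data\<close>
  assumes Y: "compact Y"
    and mu: "prob_on Xdom \<mu>" "absolutely_continuous lborel \<mu>"
    and nu: "prob_on Y \<nu>"
    and c: "C1_on (Xdom \<times> Y) c"
    and init: "\<pi>init \<in> couplings \<mu> \<nu>"
    and cell_pos: "\<And>n i. n \<in> twoN \<Longrightarrow> i \<in> idx n \<Longrightarrow> measure \<mu> (cell n i) > 0"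
    and mun: "\<And>n. n \<in> twoN \<Longrightarrow> prob_on Xdom (\<mu>n n)"
      "\<And>n i. n \<in> twoN \<Longrightarrow> i \<in> idx n \<Longrightarrow> measure (\<mu>n n) (cell n i) = measure \<mu> (cell n i)"
      "\<And>n i. n \<in> twoN \<Longrightarrow> i \<in> idx n \<Longrightarrow> emeasure (\<mu>n n) (frontier (cell n i)) = 0"
    and nun: "\<And>n. n \<in> twoN \<Longrightarrow> prob_on Y (\<nu>n n)"
      "weak_star_on (along twoN) Y \<nu>n \<nu>"
    and ninit: "\<And>n. n \<in> twoN \<Longrightarrow> \<pi>ninit n \<in> couplings (\<mu>n n) (\<nu>n n)"
      "weak_star_on (along twoN) (Xdom \<times> Y) \<pi>ninit \<pi>init"
    and cn: "\<And>n q. n \<in> twoN \<Longrightarrow> q \<in> Xdom \<times> Y \<Longrightarrow> cn n q = c q + f n q / n"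
      "\<And>n. n \<in> twoN \<Longrightarrow> continuous_on (Xdom \<times> Y) (cn n)"
      "uniform_limit (Xdom \<times> Y) f (\<lambda>_. 0) (along twoN)"
    and eps: "\<And>n. n \<in> twoN \<Longrightarrow> \<epsilon> n \<ge> 0"
      "((\<lambda>n. ennreal (n * \<epsilon> n)) \<longlongrightarrow> \<eta>) (along twoN)"
  \<comment> \<open>domain decomposition iterates\<close>
    and P0: "\<And>n. n \<in> twoN \<Longrightarrow> P n 0 = \<pi>ninit n"
    and P_sum: "\<And>n k. n \<in> twoN \<Longrightarrow> k \<ge> 1 \<Longrightarrow> P n k = msum (part n k) (PJ n k)"
    and PJ_min: "\<And>n k J. n \<in> twoN \<Longrightarrow> k \<ge> 1 \<Longrightarrow> J \<in> part n k \<Longrightarrow>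
      is_arg_min
        (cell_objective (cn n) (\<epsilon> n) (ccell n J \<times> Y) (restr (\<mu>n n) (ccell n J)) (\<nu>n n))
        (\<lambda>\<pi>. \<pi> \<in> couplings (restr (\<mu>n n) (ccell n J)) (Ymarg Y (P n (k - 1)) (ccell n J)))
        (PJ n k J)"
  \<comment> \<open>assumption (A)\<close>
    and N: "N \<subseteq> twoN" "infinite N"
    and p_kernel: "(\<lambda>(t, x). p t x) \<in> borel \<rightarrow>\<^sub>M prob_algebra borel"
    and p_coupling: "AE t in time. fibre_prod \<mu> (p t) \<in> couplings \<mu> \<nu>"
    and p_conv: "AE t in time. ((\<lambda>n. \<integral>\<^sup>+ x. W1 (disc_traj \<mu> Y P n t x) (p t x) \<partial>\<mu>) \<longlongrightarrow> 0) (along N)"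
  \<comment> \<open>assumption (B)\<close>
    and sigma: "prob_on Zdom \<sigma>" "\<And>l. emeasure \<sigma> {z \<in> Zdom. z $ l = 0} = 0"
      "AE (t, x) in time \<Otimes>\<^sub>M \<mu>. weak_star_on (along twoN) Zdom (\<lambda>n. scaled_marg \<mu> \<mu>n n t x) \<sigma>"
  \<comment> \<open>weak* limit of the scaled plans\<close>
    and N': "N' \<subseteq> N" "infinite N'"
    and Lam_kernel: "(\<lambda>(t, x). \<Lambda> t x) \<in> borel \<rightarrow>\<^sub>M prob_algebra borel"
    and Lam_conv: "\<And>T. T > 0 \<Longrightarrow> weak_star_on (along N') ({0..T} \<times> Xdom \<times> Zdom \<times> Y)
      (\<lambda>n. traj_measure \<mu> (scaled_plan \<mu> Y P n)) (traj_measure \<mu> \<Lambda>)"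
    and Lam_min: "AE (t, x) in time \<Otimes>\<^sub>M \<mu>.
      is_arg_min (fibre_objective c Y \<eta> x \<sigma> (p t x)) (\<lambda>\<gamma>. \<gamma> \<in> couplings \<sigma> (p t x)) (\<Lambda> t x)"
  shows
    "(\<forall>n\<in>twoN. AE t in time. AE x in \<mu>. \<forall>l.
        abs_cont (disc_traj \<mu> Y P n t x) (\<lambda>A. disc_mom \<mu> Y P n t x A $ l) \<and>
        (\<exists>g. is_RN_deriv (disc_traj \<mu> Y P n t x) (\<lambda>A. disc_mom \<mu> Y P n t x A $ l) g) \<and>
        (\<forall>g. is_RN_deriv (disc_traj \<mu> Y P n t x) (\<lambda>A. disc_mom \<mu> Y P n t x A $ l) g \<longrightarrow>
          (AE y in disc_traj \<mu> Y P n t x. \<bar>g y\<bar> \<le> 1))) \<and>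
     (AE t in time. AE x in \<mu>. \<forall>l.
        abs_cont (p t x) (\<lambda>A. limit_mom Y \<Lambda> t x A $ l) \<and>
        (\<exists>g. is_RN_deriv (p t x) (\<lambda>A. limit_mom Y \<Lambda> t x A $ l) g) \<and>
        (\<forall>g. is_RN_deriv (p t x) (\<lambda>A. limit_mom Y \<Lambda> t x A $ l) g \<longrightarrow>
          (AE y in p t x. \<bar>g y\<bar> \<le> 1))) \<and>
     (\<forall>n\<in>twoN. abs_cont (traj_measure \<mu> (disc_traj \<mu> Y P n)) (traj_vmeasure \<mu> (disc_mom \<mu> Y P n))) \<and>
     abs_cont (traj_measure \<mu> p) (traj_vmeasure \<mu> (limit_mom Y \<Lambda>))"
proof (intro conjI ballI)
  have Yb: "Y \<in> sets borel" using Y by (rule borel_compact)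
  interpret mu: prob_space \<mu> using mu(1) by (simp add: prob_on_def)
  have mu_sets: "sets \<mu> = sets borel" using mu(1) by (simp add: prob_on_def)
  have in_X: "AE x in \<mu>. x \<in> Xdom"
  proof -
    have "- Xdom \<in> null_sets \<mu>"
      using mu(1) borel_comp[OF borel_Xdom] by (simp add: prob_on_def null_sets_def)
    from AE_not_in[OF this] show ?thesis by simp
  qed
  have P: "sets (P n k) = sets borel" "finite_measure (P n k)" if n: "n \<in> twoN" for n k
  proof -
    have "sets (P n k) = sets borel \<and> finite_measure (P n k)"
    proof (rule iterate_finite)
      show "P n 0 \<in> couplings (\<mu>n n) (\<nu>n n)" using P0 ninit(1) n by simp
      show "PJ n k J \<in> couplings (restr (\<mu>n n) (ccell n J)) (Ymarg Y (P n (k - 1)) (ccell n J))"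
        if "1 \<le> k" "J \<in> part n k" for k J
        using PJ_min[OF n that] by (simp add: is_arg_min_def)
    qed (use mun(1) P_sum n in auto)
    then show "sets (P n k) = sets borel" "finite_measure (P n k)" by auto
  qed
  have p: "finite_measure (p t x)" "sets (p t x) = sets borel" for t x
    using measurable_space[OF p_kernel, of "(t, x)"]
    by (auto simp: space_prob_algebra prob_space_def)
  have disc: "AE t in time. AE x in \<mu>. \<forall>l.
        unit_density (disc_traj \<mu> Y P n t x) (\<lambda>A. disc_mom \<mu> Y P n t x A $ l)" if n: "n \<in> twoN" for n
  proof (rule AE_I2)
    fix t
    show "AE x in \<mu>. \<forall>l.
        unit_density (disc_traj \<mu> Y P n t x) (\<lambda>A. disc_mom \<mu> Y P n t x A $ l)"
      using in_X
    proof eventually_elim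
      case (elim x)
      have "n > 0" using n by (simp add: twoN_def)
      then show ?case using elim cell_pos[OF n] P[OF n] Yb by (intro allI disc_mom_RN_deriv)
    qed
  qed
  then show "AE t in time. AE x in \<mu>. \<forall>l.
        unit_density (disc_traj \<mu> Y P n t x) (\<lambda>A. disc_mom \<mu> Y P n t x A $ l)" if "n \<in> twoN" for n
    using that .
  show "abs_cont (traj_measure \<mu> (disc_traj \<mu> Y P n)) (traj_vmeasure \<mu> (disc_mom \<mu> Y P n))"
    if n: "n \<in> twoN" for n
  proof (rule traj_vmeasure_abs_cont)
    show "AE t in time. AE x in \<mu>. \<forall>l. abs_cont (disc_traj \<mu> Y P n t x) (\<lambda>A. disc_mom \<mu> Y P n t x A $ l)"
      using disc[OF n] by (rule eventually_mono) (erule eventually_mono, blast)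
    show "(\<lambda>(t, x). emeasure (disc_traj \<mu> Y P n t x) {y. (t, x, y) \<in> A}) \<in> borel_measurable borel"
      if "A \<in> sets borel" for A
      using P[OF n] Yb that by (intro measurable_disc_traj)
  qed (use mu.sigma_finite_measure_axioms mu_sets in auto)
  interpret T: pair_sigma_finite time \<mu>
    by (intro pair_sigma_finite.intro sigma_finite_time mu.sigma_finite_measure_axioms)
  have sigma_mass: "emeasure \<sigma> UNIV \<noteq> \<infinity>"
  proof -
    interpret sigma: prob_space \<sigma> using sigma(1) by (simp add: prob_on_def)
    show ?thesis by simp
  qed
  have "AE t in time. AE x in \<mu>. \<Lambda> t x \<in> couplings \<sigma> (p t x)"
    using T.AE_pair[OF Lam_min] by (auto simp: is_arg_min_def elim!: eventually_mono)
  then show lim: "AE t in time. AE x in \<mu>. \<forall>l.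
        unit_density (p t x) (\<lambda>A. limit_mom Y \<Lambda> t x A $ l)"
  proof (rule eventually_mono)
    fix t assume "AE x in \<mu>. \<Lambda> t x \<in> couplings \<sigma> (p t x)"
    then show "AE x in \<mu>. \<forall>l.
        unit_density (p t x) (\<lambda>A. limit_mom Y \<Lambda> t x A $ l)"
    proof (rule eventually_mono, intro allI)
      fix x l assume "\<Lambda> t x \<in> couplings \<sigma> (p t x)"
      then show "unit_density (p t x) (\<lambda>A. limit_mom Y \<Lambda> t x A $ l)"
        using sigma_mass p Yb by (rule limit_mom_RN_deriv)
    qed
  qed
  show "abs_cont (traj_measure \<mu> p) (traj_vmeasure \<mu> (limit_mom Y \<Lambda>))"
  proof (rule traj_vmeasure_abs_cont)
    show "AE t in time. AE x in \<mu>. \<forall>l. abs_cont (p t x) (\<lambda>A. limit_mom Y \<Lambda> t x A $ l)"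
      using lim by (rule eventually_mono) (erule eventually_mono, blast)
    fix A :: "(real \<times> (real^'d) \<times> (real^'d)) set" assume A: "A \<in> sets borel"
    have "(\<lambda>q. emeasure ((\<lambda>(t, x). p t x) q) {y. (fst q, snd q, y) \<in> A}) \<in> borel_measurable borel"
    proof (rule emeasure_measurable_subprob_algebra2)
      show "(\<lambda>(t, x). p t x) \<in> borel \<rightarrow>\<^sub>M subprob_algebra borel"
        by (rule measurable_prob_algebraD[OF p_kernel])
      have "(SIGMA q:space borel. {y. (fst q, snd q, y) \<in> A})
          = (\<lambda>q. (fst (fst q), snd (fst q), snd q)) -` A" by auto
      then show "(SIGMA q:space borel. {y. (fst q, snd q, y) \<in> A}) \<in> sets (borel \<Otimes>\<^sub>M borel)"
        using sets_borel_reassoc[OF A] by simp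
    qed
    then show "(\<lambda>(t, x). emeasure (p t x) {y. (t, x, y) \<in> A}) \<in> borel_measurable borel"
      by (simp add: case_prod_unfold)
  qed (use mu.sigma_finite_measure_axioms mu_sets p in auto)
qed

end
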